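(* Let $m\ge2$, $d\ge1$ be integers. Then $$\langle UV\rangle_0=\langle VU\rangle_0,\qquad\forall\,U,V\in C\ell^{\frac1m}_d.$$
   Context: The generalized Clifford algebra $C\ell^{\frac1m}_d$ is the unital associative algebra over $\mathbb{C}$ with identity $e$ and generators $e_1,\dots,e_d$ subject to $e_j^m=e$ for $j=1,\dots,d$ and $e_ke_l=\omega e_le_k$ for $k<l$, where $\omega:=e^{2\pi i/m}$. It has dimension $m^d$ with basis $e_1^{j_1}\cdots e_d^{j_d}$, $0\le j_1,\dots,j_d\le m-1$, so each element is uniquely $U=\sum u_{j_1\ldots j_d}e_1^{j_1}\cdots e_d^{j_d}$ with $u_{j_1\ldots j_d}\in\mathbb{C}$. The projection onto grade $0$ is $\langle U\rangle_0:=u_{0\ldots0}e\equiv u_{0\ldots0}\in\mathbb{C}$. *)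

theory Defs
  imports
    Complex_Main
    "HOL-Library.Poly_Mapping"
    "HOL-Library.FuncSet"
    "HOL-Algebra.QuotRing"
    "HOL-Algebra.Module"
begin

text \<open>
  The algebra is constructed from its presentation, as the quotient of a free associative
  algebra over the complex numbers by the two-sided ideal generated by the relations.
  Words are wrapped in a type of their own so that concatenation can be the (non-commutative)
  addition of a \<^class>\<open>monoid_add\<close>; then the type of finitely supported functions from words to
  the complex numbers, with its convolution product, is the free algebra as a \<^class>\<open>ring_1\<close>.
\<close>

datatype 'a free_mon = Word (letters: "'a list")

instantiation free_mon :: (type) monoid_add
begin

definition "0 = Word []"
definition "v + w = Word (letters v @ letters w)"

instance
  by standard (simp_all add: zero_free_mon_def plus_free_mon_def)

end

type_synonym free_poly = "nat free_mon \<Rightarrow>\<^sub>0 complex"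

definition free_scalar :: "complex \<Rightarrow> free_poly" where
  "free_scalar c = Poly_Mapping.single 0 c"

definition free_gen :: "nat \<Rightarrow> free_poly" where
  "free_gen j = Poly_Mapping.single (Word [j]) 1"

definition free_alg :: "nat \<Rightarrow> free_poly ring" where
  "free_alg d = \<lparr>carrier = {p. \<forall>w \<in> Poly_Mapping.keys p. set (letters w) \<subseteq> {1..d}},
     mult = (*), one = 1, zero = 0, add = (+)\<rparr>"

lemma ring_free_alg: "ring (free_alg d)"
proof (rule ringI)
  have sum_closed: "p + q \<in> carrier (free_alg d)"
    if "p \<in> carrier (free_alg d)" "q \<in> carrier (free_alg d)" for p q
    using that keys_add[of p q] unfolding free_alg_def by auto
  have uminus_closed: "- p \<in> carrier (free_alg d)" if "p \<in> carrier (free_alg d)" for p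
  proof -
    have "Poly_Mapping.keys (- p) = Poly_Mapping.keys p"
      by (auto simp: in_keys_iff)
    then show ?thesis
      using that by (simp add: free_alg_def)
  qed
  have prod_closed: "p * q \<in> carrier (free_alg d)"
    if "p \<in> carrier (free_alg d)" "q \<in> carrier (free_alg d)" for p q
  proof -
    have "set (letters w) \<subseteq> {1..d}" if w: "w \<in> Poly_Mapping.keys (p * q)" for w
    proof -
      obtain u v where "u \<in> Poly_Mapping.keys p" "v \<in> Poly_Mapping.keys q" "w = u + v"
        using w keys_mult[of p q] by blast
      then show ?thesis
        using \<open>p \<in> _\<close> \<open>q \<in> _\<close> by (simp add: free_alg_def plus_free_mon_def)
    qed
    then show ?thesis
      by (simp add: free_alg_def)
  qed
  have zero_closed: "0 \<in> carrier (free_alg d)"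
    by (simp add: free_alg_def)
  have one_closed: "1 \<in> carrier (free_alg d)"
    by (simp add: free_alg_def zero_free_mon_def)
  have ops: "x \<oplus>\<^bsub>free_alg d\<^esub> y = x + y" "x \<otimes>\<^bsub>free_alg d\<^esub> y = x * y"
    "\<zero>\<^bsub>free_alg d\<^esub> = 0" "\<one>\<^bsub>free_alg d\<^esub> = 1" for x y
    by (simp_all add: free_alg_def)
  show "abelian_group (free_alg d)"
  proof (rule abelian_groupI, unfold ops)
    fix x assume "x \<in> carrier (free_alg d)"
    then show "\<exists>y\<in>carrier (free_alg d). y + x = 0"
      using uminus_closed by (intro bexI[of _ "- x"]) auto
  qed (simp_all add: sum_closed zero_closed add_ac)
  show "monoid (free_alg d)"
    by (rule monoidI, unfold ops) (simp_all add: prod_closed one_closed mult.assoc)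
  show "(x \<oplus>\<^bsub>free_alg d\<^esub> y) \<otimes>\<^bsub>free_alg d\<^esub> z =
      x \<otimes>\<^bsub>free_alg d\<^esub> z \<oplus>\<^bsub>free_alg d\<^esub> y \<otimes>\<^bsub>free_alg d\<^esub> z" for x y z
    by (simp add: ops distrib_right)
  show "z \<otimes>\<^bsub>free_alg d\<^esub> (x \<oplus>\<^bsub>free_alg d\<^esub> y) =
      z \<otimes>\<^bsub>free_alg d\<^esub> x \<oplus>\<^bsub>free_alg d\<^esub> z \<otimes>\<^bsub>free_alg d\<^esub> y" for x y z
    by (simp add: ops distrib_left)
qed

definition gca_root :: "nat \<Rightarrow> complex" where
  "gca_root m = exp (2 * of_real pi * \<i> / of_nat m)"

definition gca_relators :: "nat \<Rightarrow> nat \<Rightarrow> free_poly set" where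
  "gca_relators m d =
     {free_gen j ^ m - 1 | j. j \<in> {1..d}} \<union>
     {free_gen k * free_gen l - free_scalar (gca_root m) * (free_gen l * free_gen k) | k l.
        k \<in> {1..d} \<and> l \<in> {1..d} \<and> k < l}"

lemma free_scalar_carrier: "free_scalar c \<in> carrier (free_alg d)"
  by (simp add: free_alg_def free_scalar_def zero_free_mon_def)

lemma free_gen_carrier: "j \<in> {1..d} \<Longrightarrow> free_gen j \<in> carrier (free_alg d)"
  by (simp add: free_alg_def free_gen_def)

lemma gca_relators_carrier: "gca_relators m d \<subseteq> carrier (free_alg d)"
proof -
  interpret F: ring "free_alg d" by (rule ring_free_alg)
  have mult: "p * q \<in> carrier (free_alg d)"
    if "p \<in> carrier (free_alg d)" "q \<in> carrier (free_alg d)" for p q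
    using F.m_closed[OF that] by (simp add: free_alg_def)
  have one: "1 \<in> carrier (free_alg d)"
    using F.one_closed by (simp add: free_alg_def)
  have diff: "p - q \<in> carrier (free_alg d)"
    if "p \<in> carrier (free_alg d)" "q \<in> carrier (free_alg d)" for p q
  proof -
    have "Poly_Mapping.keys (p - q) \<subseteq> Poly_Mapping.keys p \<union> Poly_Mapping.keys q"
      by (auto simp: in_keys_iff lookup_minus)
    then show ?thesis
      using that by (auto simp: free_alg_def)
  qed
  have pow: "p ^ n \<in> carrier (free_alg d)" if "p \<in> carrier (free_alg d)" for p n
    by (induction n) (use that mult one in auto)
  show ?thesis
    unfolding gca_relators_def
    by (auto intro!: diff mult pow one free_gen_carrier free_scalar_carrier)
qed

definition gca_ideal :: "nat \<Rightarrow> nat \<Rightarrow> free_poly set" where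
  "gca_ideal m d = Idl\<^bsub>free_alg d\<^esub> (gca_relators m d)"

lemma ideal_gca_ideal: "ideal (gca_ideal m d) (free_alg d)"
  unfolding gca_ideal_def by (rule ring.genideal_ideal[OF ring_free_alg gca_relators_carrier])

definition gca_class :: "nat \<Rightarrow> nat \<Rightarrow> free_poly \<Rightarrow> free_poly set" where
  "gca_class m d p = gca_ideal m d +>\<^bsub>free_alg d\<^esub> p"

text \<open>
  A \<^typ>\<open>(complex, free_poly set) module\<close> is the quotient ring together with scalar multiplication;
  scaling by \<open>c\<close> is multiplication by the class of the constant \<open>c\<close>.
\<close>

definition gen_clifford :: "nat \<Rightarrow> nat \<Rightarrow> (complex, free_poly set) module" where
  "gen_clifford m d =
     (let Q = free_alg d Quot gca_ideal m d
      in ring.extend Q (module.fields (\<lambda>c X. gca_class m d (free_scalar c) \<otimes>\<^bsub>Q\<^esub> X)))"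

lemma gen_clifford_simps:
  "carrier (gen_clifford m d) = carrier (free_alg d Quot gca_ideal m d)"
  "X \<otimes>\<^bsub>gen_clifford m d\<^esub> Y = X \<otimes>\<^bsub>free_alg d Quot gca_ideal m d\<^esub> Y"
  "X \<oplus>\<^bsub>gen_clifford m d\<^esub> Y = X \<oplus>\<^bsub>free_alg d Quot gca_ideal m d\<^esub> Y"
  "\<one>\<^bsub>gen_clifford m d\<^esub> = \<one>\<^bsub>free_alg d Quot gca_ideal m d\<^esub>"
  "\<zero>\<^bsub>gen_clifford m d\<^esub> = \<zero>\<^bsub>free_alg d Quot gca_ideal m d\<^esub>"
  "c \<odot>\<^bsub>gen_clifford m d\<^esub> X =
     gca_class m d (free_scalar c) \<otimes>\<^bsub>free_alg d Quot gca_ideal m d\<^esub> X"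
  by (simp_all add: gen_clifford_def Let_def ring.defs module.defs)

lemma ring_gen_clifford: "ring (gen_clifford m d)"
proof -
  interpret Q: ring "free_alg d Quot gca_ideal m d"
    by (rule ideal.quotient_is_ring[OF ideal_gca_ideal])
  show ?thesis
  proof (rule ringI)
    show "abelian_group (gen_clifford m d)"
      by (rule abelian_groupI, unfold gen_clifford_simps)
        (simp_all add: Q.a_ac Q.add.l_inv_ex)
    show "monoid (gen_clifford m d)"
      by (rule monoidI, unfold gen_clifford_simps) (simp_all add: Q.m_assoc)
  qed (simp_all add: gen_clifford_simps Q.l_distr Q.r_distr)
qed

definition gca_gen :: "nat \<Rightarrow> nat \<Rightarrow> nat \<Rightarrow> free_poly set" where
  "gca_gen m d j = gca_class m d (free_gen j)"

definition gca_indices :: "nat \<Rightarrow> nat \<Rightarrow> (nat \<Rightarrow> nat) set" where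
  "gca_indices m d = {1..d} \<rightarrow>\<^sub>E {0..m - 1}"

text \<open>The ordered product \<open>e\<^sub>1 ^ j\<^sub>1 \<cdots> e\<^sub>d ^ j\<^sub>d\<close>.\<close>

definition gca_monom :: "nat \<Rightarrow> nat \<Rightarrow> (nat \<Rightarrow> nat) \<Rightarrow> free_poly set" where
  "gca_monom m d j =
     foldr (\<lambda>i X. (gca_gen m d i [^]\<^bsub>gen_clifford m d\<^esub> j i) \<otimes>\<^bsub>gen_clifford m d\<^esub> X)
       [1..<d + 1] \<one>\<^bsub>gen_clifford m d\<^esub>"

text \<open>
  The coefficient family is taken extensional on the finite index set, so that it is determined
  as a total function by the unique basis expansion of \<open>U\<close>.
\<close>

definition gca_coeffs :: "nat \<Rightarrow> nat \<Rightarrow> free_poly set \<Rightarrow> (nat \<Rightarrow> nat) \<Rightarrow> complex" where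
  "gca_coeffs m d U =
     (THE u. u \<in> gca_indices m d \<rightarrow>\<^sub>E UNIV \<and>
        U = (\<Oplus>\<^bsub>gen_clifford m d\<^esub> j \<in> gca_indices m d.
               u j \<odot>\<^bsub>gen_clifford m d\<^esub> gca_monom m d j))"

definition grade0 :: "nat \<Rightarrow> nat \<Rightarrow> free_poly set \<Rightarrow> complex" where
  "grade0 m d U = gca_coeffs m d U (\<lambda>i\<in>{1..d}. 0)"

end

(*
  Words are sorted at the price of a factor omega^-1 per inversion, so each word equals a root of
  unity times a basis monomial, which gives spanning. Conversely, the functionals sending a word to
  this root of unity if its exponents modulo m are prescribed, and to 0 otherwise, vanish on the
  defining ideal and separate the monomials, which gives independence. So the grade-0 part is the
  functional for exponents 0, and its trace property reduces to words u, v whose concatenation has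
  all letter counts divisible by m: uv and vu then have the same number of inversions modulo m.
*)
theory Submission
  imports Defs "HOL-Library.Multiset"
begin

section \<open>Inversions of words\<close>

text \<open>These are the inversions of \<open>xs @ ys\<close> that straddle the cut. The count is
  additive in both arguments, hence a bilinear form in the letter counts, which is what makes
  divisibility arguments possible.\<close>

definition crossings :: "nat list \<Rightarrow> nat list \<Rightarrow> nat" where
  "crossings xs ys = (\<Sum>x\<leftarrow>xs. length (filter (\<lambda>y. y < x) ys))"

fun inversions :: "nat list \<Rightarrow> nat" where
  "inversions [] = 0"
| "inversions (x # xs) = length (filter (\<lambda>y. y < x) xs) + inversions xs"

lemma crossings_simps [simp]:
  "crossings [] ys = 0"
  "crossings (x # xs) ys = length (filter (\<lambda>y. y < x) ys) + crossings xs ys"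
  "crossings xs [] = 0"
  by (simp_all add: crossings_def)

lemma crossings_append_left: "crossings (xs @ xs') ys = crossings xs ys + crossings xs' ys"
  by (simp add: crossings_def)

lemma crossings_append_right: "crossings xs (ys @ ys') = crossings xs ys + crossings xs ys'"
  by (induction xs) auto

lemma inversions_append: "inversions (xs @ ys) = inversions xs + inversions ys + crossings xs ys"
  by (induction xs) auto

lemma inversions_sorted: "sorted xs \<Longrightarrow> inversions xs = 0"
  by (induction xs) (auto simp: filter_empty_conv)

text \<open>Grouping equal entries turns the sum into one over distinct letters, each term carrying
  its multiplicity as a factor.\<close>

lemma dvd_sum_list_of_counts:
  fixes f :: "'a \<Rightarrow> nat"
  assumes "\<And>x. m dvd count_list xs x"
  shows "m dvd (\<Sum>x\<leftarrow>xs. f x)"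
  using assms by (simp add: sum_list_map_eq_sum_count dvd_sum)

text \<open>Puts a filtered length into the form to which \<open>dvd_sum_list_of_counts\<close>
  applies.\<close>

lemma length_filter_eq_sum_list: "length (filter P xs) = (\<Sum>x\<leftarrow>xs. of_bool (P x))"
  by (induction xs) auto

lemma dvd_crossings_left:
  assumes "\<And>x. m dvd count_list xs x"
  shows "m dvd crossings xs ys"
  unfolding crossings_def using assms by (rule dvd_sum_list_of_counts)

lemma dvd_crossings_right:
  assumes "\<And>y. m dvd count_list ys y"
  shows "m dvd crossings xs ys"
proof (induction xs)
  case (Cons x xs)
  have "m dvd length (filter (\<lambda>y. y < x) ys)"
    unfolding length_filter_eq_sum_list using assms by (rule dvd_sum_list_of_counts)
  with Cons.IH show ?case by simp
qed simp

text \<open>Both sides are congruent to \<open>- crossings xs xs\<close>.\<close>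
lemma crossings_commute_mod:
  assumes "\<And>x. m dvd count_list (xs @ ys) x"
  shows "crossings xs ys mod m = crossings ys xs mod m"
proof -
  \<comment> \<open>The word \<open>xs @ ys\<close> is crossed with \<open>xs\<close>, once on the
    right and once on the left; additivity splits both results.\<close>
  have "m dvd crossings xs xs + crossings xs ys" "m dvd crossings xs xs + crossings ys xs"
    using dvd_crossings_right[OF assms, of xs] dvd_crossings_left[OF assms, of xs]
    by (simp_all add: crossings_append_right crossings_append_left)
  \<comment> \<open>Natural numbers do not allow subtracting \<open>crossings xs xs\<close>, so a
    multiple of \<open>m\<close> is added to each side instead; the two totals then have the same
    three summands.\<close>
  then have "(crossings xs ys + (crossings xs xs + crossings ys xs)) mod m = crossings xs ys mod m"
    "(crossings ys xs + (crossings xs xs + crossings xs ys)) mod m = crossings ys xs mod m"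
    by (auto elim!: dvdE)
  then show ?thesis
    by (simp add: ac_simps)
qed

lemma count_list_replicate: "count_list (replicate n x) y = (if x = y then n else 0)"
  by (induction n) auto

section \<open>Linear functionals on the free algebra\<close>

definition lin_ext :: "('a \<Rightarrow> 'b) \<Rightarrow> ('a \<Rightarrow>\<^sub>0 'b::comm_ring_1) \<Rightarrow> 'b" where
  "lin_ext f p = (\<Sum>w \<in> Poly_Mapping.keys p. Poly_Mapping.lookup p w * f w)"

text \<open>Cancellation may shrink the support of a sum; padding with zero coefficients lets
  several polynomials be summed over one common range.\<close>

lemma lin_ext_superset:
  assumes "finite A" "Poly_Mapping.keys p \<subseteq> A"
  shows "lin_ext f p = (\<Sum>w\<in>A. Poly_Mapping.lookup p w * f w)"
  unfolding lin_ext_def using assms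
  by (intro sum.mono_neutral_left) (auto simp: in_keys_iff)

lemma lin_ext_zero [simp]: "lin_ext f 0 = 0"
  by (simp add: lin_ext_def)

lemma lin_ext_single [simp]: "lin_ext f (Poly_Mapping.single w c) = c * f w"
  by (subst lin_ext_superset[of "{w}"]) auto

lemma lin_ext_add: "lin_ext f (p + q) = lin_ext f p + lin_ext f q"
proof -
  let ?A = "Poly_Mapping.keys p \<union> Poly_Mapping.keys q"
  have "lin_ext f (p + q) = (\<Sum>w\<in>?A. Poly_Mapping.lookup (p + q) w * f w)"
    using keys_add[of p q] by (intro lin_ext_superset) auto
  also have "\<dots> = (\<Sum>w\<in>?A. Poly_Mapping.lookup p w * f w) + (\<Sum>w\<in>?A. Poly_Mapping.lookup q w * f w)"
    by (simp add: lookup_add algebra_simps sum.distrib)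
  also have "\<dots> = lin_ext f p + lin_ext f q"
    by (simp add: lin_ext_superset[of ?A])
  finally show ?thesis .
qed

lemma lin_ext_diff: "lin_ext f (p - q) = lin_ext f p - lin_ext f q"
  using lin_ext_add[of f "p - q" q] by simp

lemma lin_ext_uminus: "lin_ext f (- p) = - lin_ext f p"
  using lin_ext_diff[of f 0 p] by simp

lemma lin_ext_sum: "lin_ext f (\<Sum>i\<in>A. p i) = (\<Sum>i\<in>A. lin_ext f (p i))"
  by (induction A rule: infinite_finite_induct) (auto simp: lin_ext_add)

lemma poly_mapping_sum_single:
  "p = (\<Sum>w \<in> Poly_Mapping.keys p. Poly_Mapping.single w (Poly_Mapping.lookup p w))"
  by (rule poly_mapping_eqI) (simp add: lookup_sum lookup_single when_def in_keys_iff)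

lemma single_sum: "Poly_Mapping.single w (\<Sum>i\<in>A. c i) = (\<Sum>i\<in>A. Poly_Mapping.single w (c i))"
  by (induction A rule: infinite_finite_induct) (auto simp: single_add)

lemma lin_ext_mult_sum:
  "lin_ext f (p * q) = (\<Sum>u \<in> Poly_Mapping.keys p. \<Sum>v \<in> Poly_Mapping.keys q.
     Poly_Mapping.lookup p u * Poly_Mapping.lookup q v * f (u + v))"
proof -
  have "p * q = (\<Sum>u \<in> Poly_Mapping.keys p. \<Sum>v \<in> Poly_Mapping.keys q.
     Poly_Mapping.single (u + v) (Poly_Mapping.lookup p u * Poly_Mapping.lookup q v))"
    by (subst (1) poly_mapping_sum_single[of p], subst (1) poly_mapping_sum_single[of q])
      (simp add: sum_product mult_single)
  then show ?thesis by (simp add: lin_ext_sum)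
qed

text \<open>Evaluating one factor at a time lets a relator in the middle of a product be treated
  with fixed words on both sides.\<close>

lemma lin_ext_mult: "lin_ext f (p * q) = lin_ext (\<lambda>u. lin_ext (\<lambda>v. f (u + v)) q) p"
  unfolding lin_ext_mult_sum by (simp add: lin_ext_def sum_distrib_left mult.assoc)

text \<open>Both sides are bilinear in \<open>p\<close> and \<open>q\<close>, so symmetry on pairs
  of words suffices.\<close>

lemma lin_ext_trace:
  assumes "\<And>u v. f (u + v) = f (v + u)"
  shows "lin_ext f (p * q) = lin_ext f (q * p)"
  unfolding lin_ext_mult_sum
  by (subst sum.swap) (simp add: assms[symmetric] mult.commute assms cong: sum.cong)

section \<open>Coefficients of a word in normal form\<close>

abbreviation word_mon :: "complex \<Rightarrow> nat list \<Rightarrow> free_poly" where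
  "word_mon c xs \<equiv> Poly_Mapping.single (Word xs) c"

lemma Word_add: "Word xs + Word ys = Word (xs @ ys)"
  by (simp add: plus_free_mon_def)

lemma word_mon_mult: "word_mon c xs * word_mon c' ys = word_mon (c * c') (xs @ ys)"
  by (simp add: mult_single Word_add)

lemma free_scalar_word_mon: "free_scalar c = word_mon c []"
  by (simp add: free_scalar_def zero_free_mon_def)

lemma one_word_mon: "1 = word_mon 1 []"
  by (simp add: zero_free_mon_def flip: single_one)

lemma free_gen_power: "free_gen j ^ n = word_mon 1 (replicate n j)"
  by (induction n) (auto simp: one_word_mon free_gen_def word_mon_mult simp del: single_one)

lemma gca_root_power_self: "m > 0 \<Longrightarrow> gca_root m ^ m = 1"
  by (simp add: gca_root_def flip: exp_of_nat_mult)

lemma gca_root_nonzero [simp]: "gca_root m \<noteq> 0"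
  by (simp add: gca_root_def)

text \<open>Since omega is an \<open>m\<close>-th root of unity, only inversion numbers modulo
  \<open>m\<close> matter.\<close>

lemma inverse_gca_root_power_mod:
  assumes "m > 0"
  shows "inverse (gca_root m) ^ (n mod m) = inverse (gca_root m) ^ n"
proof -
  have "inverse (gca_root m) ^ m = 1"
    using gca_root_power_self[OF assms] by (simp add: power_inverse)
  then have "inverse (gca_root m) ^ (m * (n div m) + n mod m) = inverse (gca_root m) ^ (n mod m)"
    by (simp only: power_add power_mult) simp
  then show ?thesis by simp
qed

definition exponents :: "nat \<Rightarrow> nat list \<Rightarrow> nat \<Rightarrow> nat" where
  "exponents m xs i = count_list xs i mod m"

text \<open>
  Sorting a word costs a factor \<open>\<omega>\<^sup>-\<^sup>1\<close> per inversion, since \<open>e\<^sub>l e\<^sub>k = \<omega>\<^sup>-\<^sup>1 e\<^sub>k e\<^sub>l\<close> for \<open>k < l\<close>.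
\<close>
definition nf_coeff :: "nat \<Rightarrow> (nat \<Rightarrow> nat) \<Rightarrow> nat free_mon \<Rightarrow> complex" where
  "nf_coeff m a w =
     (if exponents m (letters w) = a then inverse (gca_root m) ^ inversions (letters w) else 0)"

text \<open>Inserting \<open>m\<close> equal letters changes one count by \<open>m\<close>. The
  block has no inversions of its own, and its crossings with either side are multiples of
  \<open>m\<close>.\<close>

lemma nf_coeff_power_relation:
  assumes "m > 0"
  shows "nf_coeff m a (Word (us @ replicate m j @ vs)) = nf_coeff m a (Word (us @ vs))"
proof -
  have "exponents m (us @ replicate m j @ vs) = exponents m (us @ vs)"
    by (auto simp: exponents_def count_list_replicate fun_eq_iff add.left_commute)
  moreover have "inversions (us @ replicate m j @ vs) mod m = inversions (us @ vs) mod m"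
  proof -
    let ?r = "replicate m j"
    have "m dvd crossings us ?r" "m dvd crossings ?r vs"
      by (intro dvd_crossings_left dvd_crossings_right; simp add: count_list_replicate)+
    moreover have "inversions ?r = 0"
      by (simp add: inversions_sorted)
    then have "inversions (us @ ?r @ vs) =
        inversions (us @ vs) + (crossings us ?r + crossings ?r vs)"
      by (simp add: inversions_append crossings_append_right)
    ultimately show ?thesis
      by (metis dvd_add mod_add_right_eq dvd_imp_mod_0 add_0_right)
  qed
  ultimately show ?thesis
    unfolding nf_coeff_def by (metis assms free_mon.sel inverse_gca_root_power_mod)
qed

text \<open>Exchanging adjacent letters keeps all counts and all crossings with the surroundings;
  only the pair itself gains an inversion, which the factor omega compensates.\<close>

lemma nf_coeff_swap_relation:
  assumes "k < l"
  shows "nf_coeff m a (Word (us @ [k, l] @ vs)) =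
    gca_root m * nf_coeff m a (Word (us @ [l, k] @ vs))"
proof -
  have "exponents m (us @ [k, l] @ vs) = exponents m (us @ [l, k] @ vs)"
    by (auto simp: exponents_def fun_eq_iff)
  moreover have "crossings us [k, l] = crossings us [l, k]"
    by (induction us) auto
  then have "inversions (us @ [l, k] @ vs) = Suc (inversions (us @ [k, l] @ vs))"
    using assms by (simp add: inversions_append crossings_append_right)
      (metis append_Cons append_Nil crossings_append_right)
  ultimately show ?thesis
    by (simp add: nf_coeff_def)
qed

text \<open>The core of the trace property. If all counts of the concatenation vanish modulo
  \<open>m\<close>, \<open>crossings_commute_mod\<close> equates the inversion numbers modulo
  \<open>m\<close>; otherwise both values are 0.\<close>

lemma nf_coeff_zero_commute:
  assumes "m > 0"
  shows "nf_coeff m (\<lambda>_. 0) (u + v) = nf_coeff m (\<lambda>_. 0) (v + u)"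
proof (cases "exponents m (letters u @ letters v) = (\<lambda>_. 0)")
  case True
  then have "m dvd count_list (letters u @ letters v) x" for x
    by (metis exponents_def dvd_eq_mod_eq_0)
  then have "crossings (letters u) (letters v) mod m = crossings (letters v) (letters u) mod m"
    by (rule crossings_commute_mod)
  then have "inversions (letters u @ letters v) mod m = inversions (letters v @ letters u) mod m"
    unfolding inversions_append add.commute[of "inversions (letters u)"] by (rule mod_add_cong[OF refl])
  moreover have "exponents m (letters v @ letters u) = exponents m (letters u @ letters v)"
    by (simp add: exponents_def fun_eq_iff add.commute)
  ultimately show ?thesis
    unfolding nf_coeff_def plus_free_mon_def
    by (metis assms free_mon.sel inverse_gca_root_power_mod)
next
  case False
  moreover have "exponents m (letters v @ letters u) = exponents m (letters u @ letters v)"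
    by (simp add: exponents_def fun_eq_iff add.commute)
  ultimately show ?thesis
    by (simp add: nf_coeff_def plus_free_mon_def)
qed

section \<open>Vanishing of the functionals on the defining ideal\<close>

lemma free_alg_simps:
  "x \<oplus>\<^bsub>free_alg d\<^esub> y = x + y" "x \<otimes>\<^bsub>free_alg d\<^esub> y = x * y"
  "\<zero>\<^bsub>free_alg d\<^esub> = 0" "\<one>\<^bsub>free_alg d\<^esub> = 1"
  by (simp_all add: free_alg_def)

lemma uminus_carrier: "p \<in> carrier (free_alg d) \<Longrightarrow> - p \<in> carrier (free_alg d)"
  by (simp add: free_alg_def)

lemma a_inv_free_alg:
  assumes "p \<in> carrier (free_alg d)"
  shows "\<ominus>\<^bsub>free_alg d\<^esub> p = - p"
proof -
  interpret F: ring "free_alg d" by (rule ring_free_alg)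
  show ?thesis
    by (rule F.minus_equality)
      (use assms uminus_carrier in \<open>simp_all add: free_alg_simps\<close>)
qed

text \<open>Extends a relation between words in every context to arbitrary polynomial factors
  \<open>x\<close> and \<open>y\<close>, as membership in a two-sided ideal demands.\<close>

lemma lin_ext_sandwich_relation:
  assumes "\<And>u v. f (u + (s + v)) = c * f (u + (t + v))"
  shows "lin_ext f (x * ((Poly_Mapping.single s 1 - Poly_Mapping.single t c) * y)) = 0"
proof -
  have "lin_ext f (x * ((Poly_Mapping.single s 1 - Poly_Mapping.single t c) * y)) =
      lin_ext (\<lambda>u. lin_ext (\<lambda>v. f (u + (s + v))) y - c * lin_ext (\<lambda>v. f (u + (t + v))) y) x"
    by (simp add: lin_ext_mult lin_ext_diff)
  also have "\<dots> = 0"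
    by (simp add: lin_ext_def assms sum_distrib_left mult.left_commute)
  finally show ?thesis .
qed

lemma lin_ext_nf_coeff_gca_ideal:
  assumes "m > 0" "p \<in> gca_ideal m d"
  shows "lin_ext (nf_coeff m a) p = 0"
proof -
  interpret F: ring "free_alg d" by (rule ring_free_alg)
  \<comment> \<open>The kernel of the functional need not absorb products. Demanding that all
    two-sided multiples be killed gives an ideal inside the kernel, so only the relators remain to
    be checked.\<close>
  define K where "K = {r \<in> carrier (free_alg d). \<forall>x y. lin_ext (nf_coeff m a) (x * (r * y)) = 0}"
  have "ideal K (free_alg d)"
  proof (rule idealI[OF ring_free_alg])
    show "subgroup K (add_monoid (free_alg d))"
    proof (rule F.add.subgroupI)
      show "K \<subseteq> carrier (free_alg d)" by (auto simp: K_def)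
      have "0 \<in> K" using F.zero_closed by (simp add: K_def free_alg_simps)
      then show "K \<noteq> {}" by auto
      show "\<ominus>\<^bsub>free_alg d\<^esub> r \<in> K" if "r \<in> K" for r
        using that by (simp add: K_def a_inv_free_alg uminus_carrier lin_ext_uminus)
      show "r \<oplus>\<^bsub>free_alg d\<^esub> s \<in> K" if "r \<in> K" "s \<in> K" for r s
        using that F.add.m_closed[of r s]
        by (simp add: K_def free_alg_simps distrib_left distrib_right lin_ext_add)
    qed
    show "q \<otimes>\<^bsub>free_alg d\<^esub> r \<in> K" if "r \<in> K" "q \<in> carrier (free_alg d)" for r q
      using that F.m_closed[of q r]
      by (simp add: K_def free_alg_simps mult.assoc) (metis mult.assoc)
    show "r \<otimes>\<^bsub>free_alg d\<^esub> q \<in> K" if "r \<in> K" "q \<in> carrier (free_alg d)" for r q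
      using that F.m_closed[of r q] by (simp add: K_def free_alg_simps mult.assoc)
  qed
  moreover have "gca_relators m d \<subseteq> K"
  proof
    fix r assume r: "r \<in> gca_relators m d"
    have "lin_ext (nf_coeff m a) (x * (r * y)) = 0" for x y
    proof -
      \<comment> \<open>Both families of relators have the shape word minus scalar times word:
        \<open>t\<close> is empty and \<open>c = 1\<close> for powers, \<open>c\<close> is omega for
        commutation.\<close>
      obtain s t c where "r = word_mon 1 s - word_mon c t"
        "\<And>us vs. nf_coeff m a (Word (us @ s @ vs)) = c * nf_coeff m a (Word (us @ t @ vs))"
      proof -
        consider j where "r = free_gen j ^ m - 1"
          | k l where "k < l"
            "r = free_gen k * free_gen l - free_scalar (gca_root m) * (free_gen l * free_gen k)"
          using r unfolding gca_relators_def by blast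
        then show ?thesis
        proof cases
          case 1
          show ?thesis
            by (rule that[of "replicate m j" "[]" 1])
              (simp_all add: 1 free_gen_power one_word_mon nf_coeff_power_relation assms
                del: single_one)
        next
          case 2
          show ?thesis
            by (rule that[of "[k, l]" "[l, k]" "gca_root m"])
              (use nf_coeff_swap_relation[OF 2(1)] in
                \<open>simp_all add: 2 free_gen_def free_scalar_word_mon word_mon_mult\<close>)
        qed
      qed
      then show ?thesis
        by (simp only:) (rule lin_ext_sandwich_relation, simp add: plus_free_mon_def)
    qed
    then show "r \<in> K"
      using r gca_relators_carrier[of m d] unfolding K_def by blast
  qed
  ultimately have "gca_ideal m d \<subseteq> K"
    unfolding gca_ideal_def by (rule F.genideal_minimal)
  \<comment> \<open>Trivial factors recover the functional itself.\<close>
  then have "lin_ext (nf_coeff m a) (1 * (p * 1)) = 0"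
    using assms(2) unfolding K_def by blast
  then show ?thesis by simp
qed

section \<open>Reduction to normal form\<close>

text \<open>Congruence modulo the ideal, phrased in the free algebra so that words can be rewritten
  in transitive chains without handling cosets.\<close>

definition gca_equiv :: "nat \<Rightarrow> nat \<Rightarrow> free_poly \<Rightarrow> free_poly \<Rightarrow> bool" where
  "gca_equiv m d p q \<longleftrightarrow> p - q \<in> gca_ideal m d"

lemma gca_ideal_closed:
  "0 \<in> gca_ideal m d"
  "p \<in> gca_ideal m d \<Longrightarrow> q \<in> gca_ideal m d \<Longrightarrow> p + q \<in> gca_ideal m d"
  "p \<in> gca_ideal m d \<Longrightarrow> x \<in> carrier (free_alg d) \<Longrightarrow> x * p \<in> gca_ideal m d"
  "p \<in> gca_ideal m d \<Longrightarrow> x \<in> carrier (free_alg d) \<Longrightarrow> p * x \<in> gca_ideal m d"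
proof -
  interpret I: ideal "gca_ideal m d" "free_alg d" by (rule ideal_gca_ideal)
  show "0 \<in> gca_ideal m d"
    using additive_subgroup.zero_closed[OF I.is_additive_subgroup] by (simp add: free_alg_simps)
  show "p + q \<in> gca_ideal m d" if "p \<in> gca_ideal m d" "q \<in> gca_ideal m d"
    using additive_subgroup.a_closed[OF I.is_additive_subgroup that] by (simp add: free_alg_simps)
  show "x * p \<in> gca_ideal m d" if "p \<in> gca_ideal m d" "x \<in> carrier (free_alg d)"
    using I.I_l_closed[OF that] by (simp add: free_alg_simps)
  show "p * x \<in> gca_ideal m d" if "p \<in> gca_ideal m d" "x \<in> carrier (free_alg d)"
    using I.I_r_closed[OF that] by (simp add: free_alg_simps)
qed

lemma gca_equiv_refl [simp]: "gca_equiv m d p p"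
  by (simp add: gca_equiv_def gca_ideal_closed)

lemma gca_equiv_trans [trans]:
  "gca_equiv m d p q \<Longrightarrow> gca_equiv m d q r \<Longrightarrow> gca_equiv m d p r"
  unfolding gca_equiv_def using gca_ideal_closed(2)[of "p - q" m d "q - r"] by simp

lemma gca_equiv_sum:
  "(\<And>i. i \<in> A \<Longrightarrow> gca_equiv m d (f i) (g i)) \<Longrightarrow> gca_equiv m d (\<Sum>i\<in>A. f i) (\<Sum>i\<in>A. g i)"
proof (induction A rule: infinite_finite_induct)
  case (insert i A)
  then have "(f i - g i) + (sum f A - sum g A) \<in> gca_ideal m d"
    by (intro gca_ideal_closed) (auto simp: gca_equiv_def)
  with insert.hyps show ?case
    by (simp add: gca_equiv_def algebra_simps)
qed auto

lemma word_mon_carrier: "set xs \<subseteq> {1..d} \<Longrightarrow> word_mon c xs \<in> carrier (free_alg d)"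
  by (simp add: free_alg_def)

text \<open>Permits rewriting inside a word, by multiplying the difference with
  \<open>word_mon c us\<close> and \<open>word_mon 1 vs\<close>. The letters are bounded because the
  ideal absorbs factors from the carrier.\<close>

lemma gca_equiv_word_context:
  assumes "gca_equiv m d (word_mon a xs) (word_mon b ys)" "set us \<subseteq> {1..d}" "set vs \<subseteq> {1..d}"
  shows "gca_equiv m d (word_mon (c * a) (us @ xs @ vs)) (word_mon (c * b) (us @ ys @ vs))"
proof -
  have "word_mon c us * ((word_mon a xs - word_mon b ys) * word_mon 1 vs) \<in> gca_ideal m d"
    using assms by (intro gca_ideal_closed word_mon_carrier) (auto simp: gca_equiv_def)
  then show ?thesis
    by (simp add: gca_equiv_def left_diff_distrib right_diff_distrib word_mon_mult)
qed

lemma gca_relators_subset_ideal: "gca_relators m d \<subseteq> gca_ideal m d"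
  unfolding gca_ideal_def by (rule ring.genideal_self[OF ring_free_alg gca_relators_carrier])

lemma gca_equiv_swap:
  assumes "k \<in> {1..d}" "l \<in> {1..d}" "k < l"
  shows "gca_equiv m d (word_mon 1 [l, k]) (word_mon (inverse (gca_root m)) [k, l])"
proof -
  have "free_gen k * free_gen l - free_scalar (gca_root m) * (free_gen l * free_gen k) \<in> gca_ideal m d"
    using assms gca_relators_subset_ideal[of m d] unfolding gca_relators_def by blast
  \<comment> \<open>Scaling the relator by minus the inverse of omega isolates the word
    \<open>[l, k]\<close> with coefficient 1.\<close>
  then have "word_mon (- inverse (gca_root m)) [] *
      (word_mon 1 [k, l] - word_mon (gca_root m) [l, k]) \<in> gca_ideal m d"
    by (intro gca_ideal_closed word_mon_carrier)
      (simp_all add: free_gen_def free_scalar_word_mon word_mon_mult)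
  then show ?thesis
    by (simp add: gca_equiv_def right_diff_distrib word_mon_mult single_uminus)
qed

lemma gca_equiv_power:
  assumes "j \<in> {1..d}"
  shows "gca_equiv m d (word_mon 1 (replicate m j)) (word_mon 1 [])"
proof -
  have "free_gen j ^ m - 1 \<in> gca_ideal m d"
    using assms gca_relators_subset_ideal[of m d] unfolding gca_relators_def by blast
  then show ?thesis
    by (simp add: gca_equiv_def free_gen_power one_word_mon del: single_one)
qed

text \<open>In a sorted list the entries below \<open>x\<close> come first; \<open>x\<close> moves
  past exactly these, each exchange costing one inverse of omega.\<close>

lemma gca_equiv_insort:
  assumes "set (x # xs) \<subseteq> {1..d}" "sorted xs"
  shows "gca_equiv m d (word_mon c (x # xs))
    (word_mon (c * inverse (gca_root m) ^ length (filter (\<lambda>y. y < x) xs)) (insort x xs))"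
  using assms
proof (induction xs arbitrary: c)
  case (Cons y ys)
  show ?case
  proof (cases "x \<le> y")
    case True
    then have "filter (\<lambda>z. z < x) (y # ys) = []"
      using Cons.prems by (force simp: filter_empty_conv)
    with True show ?thesis by (simp del: filter.simps)
  next
    case False
    let ?z = "inverse (gca_root m)" and ?n = "length (filter (\<lambda>z. z < x) ys)"
    have "gca_equiv m d (word_mon 1 [x, y]) (word_mon ?z [y, x])"
      using False Cons.prems by (intro gca_equiv_swap) auto
    from gca_equiv_word_context[OF this, of "[]" ys c]
    have "gca_equiv m d (word_mon c (x # y # ys)) (word_mon (c * ?z) (y # x # ys))"
      using Cons.prems by simp
    also have "gca_equiv m d (word_mon (c * ?z) (x # ys)) (word_mon (c * ?z * ?z ^ ?n) (insort x ys))"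
      using Cons.prems by (intro Cons.IH) auto
    from gca_equiv_word_context[OF this, of "[y]" "[]" 1]
    have "gca_equiv m d (word_mon (c * ?z) (y # x # ys)) (word_mon (c * ?z * ?z ^ ?n) (y # insort x ys))"
      using Cons.prems by simp
    finally show ?thesis
      using False by (simp add: mult.assoc)
  qed
qed simp

text \<open>Insertion sort mirrors the recursion of \<open>inversions\<close>: sort the tail, then
  insert the head. Sorting the tail does not change how many of its entries lie below the
  head.\<close>

lemma gca_equiv_sort:
  assumes "set xs \<subseteq> {1..d}"
  shows "gca_equiv m d (word_mon c xs)
    (word_mon (c * inverse (gca_root m) ^ inversions xs) (sort xs))"
  using assms
proof (induction xs arbitrary: c)
  case (Cons x xs)
  let ?z = "inverse (gca_root m)" and ?n = "length (filter (\<lambda>y. y < x) xs)"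
  have "gca_equiv m d (word_mon c xs) (word_mon (c * ?z ^ inversions xs) (sort xs))"
    using Cons by simp
  from gca_equiv_word_context[OF this, of "[x]" "[]" 1]
  have "gca_equiv m d (word_mon c (x # xs)) (word_mon (c * ?z ^ inversions xs) (x # sort xs))"
    using Cons.prems by simp
  also have "gca_equiv m d (word_mon (c * ?z ^ inversions xs) (x # sort xs))
      (word_mon (c * ?z ^ inversions xs * ?z ^ ?n) (sort (x # xs)))"
    using gca_equiv_insort[of x "sort xs" d m "c * ?z ^ inversions xs"] Cons.prems
    by (simp add: filter_sort)
  finally show ?case
    by (simp add: power_add ac_simps)
qed simp

section \<open>Normal words and reduction of exponents modulo \<open>m\<close>\<close>

definition blocks :: "(nat \<Rightarrow> nat) \<Rightarrow> nat list \<Rightarrow> nat list" where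
  "blocks j is = concat (map (\<lambda>i. replicate (j i) i) is)"

abbreviation normal_word :: "nat \<Rightarrow> (nat \<Rightarrow> nat) \<Rightarrow> nat list" where
  "normal_word d j \<equiv> blocks j [1..<d + 1]"

lemma blocks_simps [simp]:
  "blocks j [] = []" "blocks j (i # is) = replicate (j i) i @ blocks j is"
  by (simp_all add: blocks_def)

lemma set_blocks: "set (blocks j is) \<subseteq> set is"
  by (auto simp: blocks_def)

lemma count_list_blocks:
  "distinct is \<Longrightarrow> count_list (blocks j is) x = (if x \<in> set is then j x else 0)"
  by (induction "is") (auto simp: count_list_replicate)

lemma sorted_blocks: "sorted is \<Longrightarrow> sorted (blocks j is)"
  by (induction "is") (use set_blocks in \<open>fastforce simp: sorted_append\<close>)+

text \<open>A sorted list is determined by its multiset of entries.\<close>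

lemma sort_eq_normal_word:
  assumes "set xs \<subseteq> {1..d}"
  shows "sort xs = normal_word d (count_list xs)"
proof (rule properties_for_sort)
  show "mset (normal_word d (count_list xs)) = mset xs"
    using assms by (intro multiset_eqI)
      (auto simp: count_mset count_list_blocks count_list_0_iff simp del: upt_Suc)
  show "sorted (normal_word d (count_list xs))"
    by (rule sorted_blocks) (simp del: upt_Suc)
qed

text \<open>Copies are removed \<open>m\<close> at a time, hence the strong induction on
  \<open>n\<close>.\<close>

lemma gca_equiv_replicate_mod:
  assumes "i \<in> {1..d}" "m > 0"
  shows "gca_equiv m d (word_mon 1 (replicate n i)) (word_mon 1 (replicate (n mod m) i))"
proof (induction n rule: less_induct)
  case (less n)
  show ?case
  proof (cases "n < m")
    case False
    have "gca_equiv m d (word_mon 1 (replicate m i @ replicate (n - m) i))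
        (word_mon 1 (replicate (n - m) i))"
      using gca_equiv_word_context[OF gca_equiv_power[OF assms(1)], of "[]" "replicate (n - m) i" m 1] assms(1)
      by (simp add: set_replicate_conv_if)
    also have "gca_equiv m d \<dots> (word_mon 1 (replicate ((n - m) mod m) i))"
      using False assms by (intro less) auto
    finally show ?thesis
      using False by (simp add: le_mod_geq flip: replicate_add)
  qed simp
qed

lemma gca_equiv_blocks_mod:
  assumes "m > 0" "set is \<subseteq> {1..d}"
  shows "gca_equiv m d (word_mon c (blocks j is)) (word_mon c (blocks (\<lambda>i. j i mod m) is))"
  using assms(2)
proof (induction "is" arbitrary: c)
  case (Cons i "is")
  have "set (blocks j is) \<subseteq> {1..d}"
    using set_blocks Cons.prems by fastforce
  then have "gca_equiv m d (word_mon c (replicate (j i) i @ blocks j is))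
      (word_mon c (replicate (j i mod m) i @ blocks j is))"
    using gca_equiv_word_context[OF gca_equiv_replicate_mod[of i d m "j i"], of "[]" "blocks j is" c]
      Cons.prems assms(1) by simp
  also have "gca_equiv m d \<dots> (word_mon c (replicate (j i mod m) i @ blocks (\<lambda>i. j i mod m) is))"
    using gca_equiv_word_context[OF Cons.IH, of "replicate (j i mod m) i" "[]" c 1] Cons.prems
    by (simp add: set_replicate_conv_if)
  finally show ?case by simp
qed simp

text \<open>The spanning half for words. The power of the inverse root is the value of
  \<open>nf_coeff\<close> at \<open>Word xs\<close> for the exponents of \<open>xs\<close>.\<close>

lemma gca_equiv_normal_word:
  assumes "m > 0" "set xs \<subseteq> {1..d}"
  shows "gca_equiv m d (word_mon c xs)
    (word_mon (c * inverse (gca_root m) ^ inversions xs) (normal_word d (exponents m xs)))"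
proof -
  note gca_equiv_sort[OF assms(2), of m c]
  also note sort_eq_normal_word[OF assms(2)]
  also have "gca_equiv m d
      (word_mon (c * inverse (gca_root m) ^ inversions xs) (normal_word d (count_list xs)))
      (word_mon (c * inverse (gca_root m) ^ inversions xs) (normal_word d (exponents m xs)))"
    unfolding exponents_def using assms(1) by (intro gca_equiv_blocks_mod) auto
  finally show ?thesis .
qed

section \<open>The quotient algebra\<close>

lemma gca_class_closed: "p \<in> carrier (free_alg d) \<Longrightarrow> gca_class m d p \<in> carrier (gen_clifford m d)"
  using ring_hom_closed[OF ideal.rcos_ring_hom[OF ideal_gca_ideal[of m d]], of p]
  by (simp add: gen_clifford_simps gca_class_def)

lemma gca_class_mult:
  "p \<in> carrier (free_alg d) \<Longrightarrow> q \<in> carrier (free_alg d) \<Longrightarrow>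
    gca_class m d p \<otimes>\<^bsub>gen_clifford m d\<^esub> gca_class m d q = gca_class m d (p * q)"
  using ring_hom_mult[OF ideal.rcos_ring_hom[OF ideal_gca_ideal[of m d]], of p q]
  by (simp add: gen_clifford_simps gca_class_def free_alg_simps)

lemma gca_class_add:
  "p \<in> carrier (free_alg d) \<Longrightarrow> q \<in> carrier (free_alg d) \<Longrightarrow>
    gca_class m d p \<oplus>\<^bsub>gen_clifford m d\<^esub> gca_class m d q = gca_class m d (p + q)"
  using ring_hom_add[OF ideal.rcos_ring_hom[OF ideal_gca_ideal[of m d]], of p q]
  by (simp add: gen_clifford_simps gca_class_def free_alg_simps)

lemma gca_class_one: "gca_class m d 1 = \<one>\<^bsub>gen_clifford m d\<^esub>"
  using ring_hom_one[OF ideal.rcos_ring_hom[OF ideal_gca_ideal[of m d]]]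
  by (simp add: gen_clifford_simps gca_class_def free_alg_simps)

lemma gca_class_zero: "gca_class m d 0 = \<zero>\<^bsub>gen_clifford m d\<^esub>"
proof -
  interpret Q: ring_hom_ring "free_alg d" "free_alg d Quot gca_ideal m d" "(+>\<^bsub>free_alg d\<^esub>) (gca_ideal m d)"
    by (rule ideal.rcos_ring_hom_ring[OF ideal_gca_ideal])
  show ?thesis
    using Q.hom_zero by (simp add: gen_clifford_simps gca_class_def free_alg_simps)
qed

lemma gca_class_smult:
  "p \<in> carrier (free_alg d) \<Longrightarrow>
    c \<odot>\<^bsub>gen_clifford m d\<^esub> gca_class m d p = gca_class m d (free_scalar c * p)"
  using gca_class_mult[OF free_scalar_carrier] by (simp add: gen_clifford_simps)

lemma gca_class_eq_iff:
  assumes "p \<in> carrier (free_alg d)" "q \<in> carrier (free_alg d)"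
  shows "gca_class m d p = gca_class m d q \<longleftrightarrow> gca_equiv m d p q"
  using ring.quotient_eq_iff_same_a_r_cos[OF ring_free_alg ideal_gca_ideal assms, of m]
  by (simp add: gca_class_def gca_equiv_def a_minus_def a_inv_free_alg assms free_alg_simps)

lemma gen_clifford_carrierE:
  assumes "U \<in> carrier (gen_clifford m d)"
  obtains p where "p \<in> carrier (free_alg d)" "U = gca_class m d p"
  using assms unfolding gen_clifford_simps gca_class_def
  by (auto simp: FactRing_def A_RCOSETS_def')

lemma sum_carrier:
  "(\<And>i. i \<in> A \<Longrightarrow> f i \<in> carrier (free_alg d)) \<Longrightarrow> (\<Sum>i\<in>A. f i) \<in> carrier (free_alg d)"
proof (induction A rule: infinite_finite_induct)
  case (insert i A)
  then show ?case
    using ring.ring_simprules(1)[OF ring_free_alg, of "f i" d "sum f A"] by (simp add: free_alg_simps)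
qed (auto simp: free_alg_def)

lemma finsum_gca_class:
  assumes "finite A" "\<And>i. i \<in> A \<Longrightarrow> f i \<in> carrier (free_alg d)"
  shows "(\<Oplus>\<^bsub>gen_clifford m d\<^esub>i\<in>A. gca_class m d (f i)) = gca_class m d (\<Sum>i\<in>A. f i)"
proof -
  interpret G: ring "gen_clifford m d" by (rule ring_gen_clifford)
  show ?thesis
    using assms
    by (induction A) (auto simp: gca_class_zero gca_class_closed gca_class_add sum_carrier)
qed

lemma gca_gen_power:
  assumes "i \<in> {1..d}"
  shows "gca_gen m d i [^]\<^bsub>gen_clifford m d\<^esub> (n::nat) = gca_class m d (word_mon 1 (replicate n i))"
proof -
  interpret G: ring "gen_clifford m d" by (rule ring_gen_clifford)
  show ?thesis
  proof (induction n)
    case 0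
    then show ?case by (simp add: one_word_mon del: single_one flip: gca_class_one)
  next
    case (Suc n)
    have "word_mon 1 (replicate n i) * free_gen i = word_mon 1 (replicate (Suc n) i)"
      by (simp add: free_gen_def word_mon_mult replicate_append_same)
    moreover have "word_mon 1 (replicate n i) \<in> carrier (free_alg d)"
      using assms by (intro word_mon_carrier) auto
    ultimately show ?case
      using Suc assms by (simp add: gca_gen_def gca_class_mult free_gen_carrier)
  qed
qed

lemma gca_monom_eq_class: "gca_monom m d j = gca_class m d (word_mon 1 (normal_word d j))"
proof -
  \<comment> \<open>Generalised from \<open>[1..<d + 1]\<close> to any list of admissible indices,
    to allow induction on the list.\<close>
  have "foldr (\<lambda>i X. (gca_gen m d i [^]\<^bsub>gen_clifford m d\<^esub> j i) \<otimes>\<^bsub>gen_clifford m d\<^esub> X)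
      is \<one>\<^bsub>gen_clifford m d\<^esub> = gca_class m d (word_mon 1 (blocks j is))"
    if "set is \<subseteq> {1..d}" for "is"
    using that
  proof (induction "is")
    case Nil
    then show ?case by (simp add: one_word_mon del: single_one flip: gca_class_one)
  next
    case (Cons i "is")
    have "word_mon 1 (replicate (j i) i) \<in> carrier (free_alg d)"
      "word_mon 1 (blocks j is) \<in> carrier (free_alg d)"
      using Cons.prems set_blocks[of j "is"] by (intro word_mon_carrier; auto)+
    then show ?case
      using Cons by (simp add: gca_gen_power gca_class_mult word_mon_mult)
  qed
  then show ?thesis
    unfolding gca_monom_def by (simp del: upt_Suc add: atLeastLessThanSuc_atLeastAtMost)
qed

section \<open>Basis coefficients\<close>

text \<open>Index families are undefined off \<open>{1..d}\<close>, whereas exponents of words vanish there.\<close>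
definition extend_zero :: "nat \<Rightarrow> (nat \<Rightarrow> nat) \<Rightarrow> nat \<Rightarrow> nat" where
  "extend_zero d j i = (if i \<in> {1..d} then j i else 0)"

text \<open>Members of \<open>gca_indices\<close> are extensional, so their values on
  \<open>{1..d}\<close> determine them.\<close>

lemma extend_zero_eq_iff:
  assumes "j \<in> gca_indices m d" "k \<in> gca_indices m d"
  shows "extend_zero d j = extend_zero d k \<longleftrightarrow> j = k"
  using assms unfolding gca_indices_def extend_zero_def
  by (metis (no_types, lifting) PiE_ext)

lemma finite_gca_indices: "finite (gca_indices m d)"
  unfolding gca_indices_def by (intro finite_PiE) auto

lemma blocks_cong: "(\<And>i. i \<in> set is \<Longrightarrow> j i = k i) \<Longrightarrow> blocks j is = blocks k is"
  unfolding blocks_def by (metis (mono_tags, lifting) map_cong)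

lemma normal_word_carrier: "word_mon c (normal_word d j) \<in> carrier (free_alg d)"
  using set_blocks[of j "[1..<d + 1]"] by (intro word_mon_carrier) auto

text \<open>The functionals are dual to the monomials: a normal word has no inversions, and its
  exponents are already reduced modulo \<open>m\<close>.\<close>

lemma nf_coeff_normal_word:
  assumes "m > 0" "j \<in> gca_indices m d" "k \<in> gca_indices m d"
  shows "nf_coeff m (extend_zero d k) (Word (normal_word d j)) = of_bool (j = k)"
proof -
  have "exponents m (normal_word d j) i = extend_zero d j i" for i
  proof (cases "i \<in> {1..d}")
    case True
    then have "j i \<in> {0..m - 1}"
      using assms(2) unfolding gca_indices_def by (rule PiE_mem[rotated])
    with True assms(1) show ?thesis
      by (auto simp: exponents_def extend_zero_def count_list_blocks simp del: upt_Suc)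
  qed (auto simp: exponents_def extend_zero_def count_list_blocks simp del: upt_Suc)
  moreover have "inversions (normal_word d j) = 0"
    by (intro inversions_sorted sorted_blocks) (simp del: upt_Suc)
  ultimately show ?thesis
    using extend_zero_eq_iff[OF assms(2,3)] by (auto simp: nf_coeff_def fun_eq_iff simp del: upt_Suc)
qed

lemma gca_equiv_expansion_word:
  assumes "m > 0" "set xs \<subseteq> {1..d}"
  shows "gca_equiv m d (word_mon c xs)
    (\<Sum>j\<in>gca_indices m d.
       word_mon (lin_ext (nf_coeff m (extend_zero d j)) (word_mon c xs)) (normal_word d j))"
proof -
  \<comment> \<open>The only index with a nonzero functional on \<open>xs\<close>, unless
    \<open>c\<close> is 0; restriction makes it extensional.\<close>
  define k where "k = restrict (exponents m xs) {1..d}"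
  have k: "k \<in> gca_indices m d"
    unfolding k_def gca_indices_def
  proof (rule restrict_PiE_iff[THEN iffD2], intro ballI)
    fix i
    show "exponents m xs i \<in> {0..m - 1}"
      using mod_less_divisor[OF assms(1), of "count_list xs i"] unfolding exponents_def by simp
  qed
  \<comment> \<open>Letters outside \<open>{1..d}\<close> do not occur, so extending
    \<open>k\<close> by zero gives back the exponents.\<close>
  have "count_list xs i = 0" if "i \<notin> {1..d}" for i
    using assms(2) that by (intro count_notin) blast
  then have exp: "exponents m xs = extend_zero d k"
    by (simp add: k_def extend_zero_def exponents_def fun_eq_iff)
  have "(\<Sum>j\<in>gca_indices m d.
        word_mon (lin_ext (nf_coeff m (extend_zero d j)) (word_mon c xs)) (normal_word d j)) =
      (\<Sum>j\<in>gca_indices m d. if j = k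
         then word_mon (c * inverse (gca_root m) ^ inversions xs) (normal_word d k) else 0)"
    using k by (intro sum.cong) (auto simp: nf_coeff_def exp extend_zero_eq_iff simp del: upt_Suc)
  also have "\<dots> = word_mon (c * inverse (gca_root m) ^ inversions xs) (normal_word d k)"
    using k by (simp add: finite_gca_indices)
  also have "normal_word d k = normal_word d (exponents m xs)"
    by (rule blocks_cong) (auto simp: k_def)
  finally show ?thesis
    using gca_equiv_normal_word[OF assms, of c] by simp
qed

text \<open>Expand each word of \<open>p\<close> separately and exchange the sums; linearity
  reassembles the coefficients.\<close>

lemma gca_equiv_expansion:
  assumes "m > 0" "p \<in> carrier (free_alg d)"
  shows "gca_equiv m d p
    (\<Sum>j\<in>gca_indices m d. word_mon (lin_ext (nf_coeff m (extend_zero d j)) p) (normal_word d j))"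
proof -
  let ?s = "\<lambda>w. Poly_Mapping.single w (Poly_Mapping.lookup p w)"
  let ?K = "Poly_Mapping.keys p"
  let ?L = "\<lambda>j q. word_mon (lin_ext (nf_coeff m (extend_zero d j)) q) (normal_word d j)"
  have "gca_equiv m d (\<Sum>w\<in>?K. ?s w) (\<Sum>w\<in>?K. \<Sum>j\<in>gca_indices m d. ?L j (?s w))"
  proof (rule gca_equiv_sum)
    fix w assume "w \<in> ?K"
    then have "set (letters w) \<subseteq> {1..d}"
      using assms(2) by (simp add: free_alg_def)
    from gca_equiv_expansion_word[OF assms(1) this, of "Poly_Mapping.lookup p w"]
    show "gca_equiv m d (?s w) (\<Sum>j\<in>gca_indices m d. ?L j (?s w))"
      by (simp only: free_mon.collapse)
  qed
  also have "(\<Sum>w\<in>?K. \<Sum>j\<in>gca_indices m d. ?L j (?s w)) = (\<Sum>j\<in>gca_indices m d. ?L j (\<Sum>w\<in>?K. ?s w))"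
    by (subst sum.swap) (simp only: lin_ext_sum single_sum)
  finally show ?thesis
    by (simp only: poly_mapping_sum_single[symmetric])
qed

text \<open>This identifies the definite description: \<open>gca_equiv_expansion\<close> gives
  existence, and the dual functionals give uniqueness.\<close>

lemma gca_coeffs_class:
  assumes "m > 0" "p \<in> carrier (free_alg d)"
  shows "gca_coeffs m d (gca_class m d p) =
    (\<lambda>j\<in>gca_indices m d. lin_ext (nf_coeff m (extend_zero d j)) p)"
proof -
  \<comment> \<open>Translates an expansion in the quotient into a congruence in the free
    algebra.\<close>
  have expansion_iff: "gca_class m d p = (\<Oplus>\<^bsub>gen_clifford m d\<^esub> j \<in> gca_indices m d.
        u j \<odot>\<^bsub>gen_clifford m d\<^esub> gca_monom m d j) \<longleftrightarrow>
      gca_equiv m d p (\<Sum>j\<in>gca_indices m d. word_mon (u j) (normal_word d j))" for u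
  proof -
    have "u j \<odot>\<^bsub>gen_clifford m d\<^esub> gca_monom m d j = gca_class m d (word_mon (u j) (normal_word d j))" for j
      using gca_class_smult[OF normal_word_carrier]
      by (simp add: gca_monom_eq_class free_scalar_word_mon word_mon_mult del: upt_Suc)
    then have finsum: "(\<Oplus>\<^bsub>gen_clifford m d\<^esub> j \<in> gca_indices m d. u j \<odot>\<^bsub>gen_clifford m d\<^esub> gca_monom m d j) =
        gca_class m d (\<Sum>j\<in>gca_indices m d. word_mon (u j) (normal_word d j))"
      using finsum_gca_class[OF finite_gca_indices normal_word_carrier] by simp
    have "(\<Sum>j\<in>gca_indices m d. word_mon (u j) (normal_word d j)) \<in> carrier (free_alg d)"
      by (rule sum_carrier) (rule normal_word_carrier)
    from gca_class_eq_iff[OF assms(2) this] show ?thesis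
      by (simp only: finsum)
  qed
  show ?thesis
    unfolding gca_coeffs_def expansion_iff
  proof (rule the_equality)
    show "(\<lambda>j\<in>gca_indices m d. lin_ext (nf_coeff m (extend_zero d j)) p) \<in> gca_indices m d \<rightarrow>\<^sub>E UNIV \<and>
        gca_equiv m d p (\<Sum>j\<in>gca_indices m d.
          word_mon ((\<lambda>j\<in>gca_indices m d. lin_ext (nf_coeff m (extend_zero d j)) p) j) (normal_word d j))"
      using gca_equiv_expansion[OF assms] by (simp del: upt_Suc cong: sum.cong_simp)
  next
    fix u :: "(nat \<Rightarrow> nat) \<Rightarrow> complex"
    let ?S = "\<Sum>j\<in>gca_indices m d. word_mon (u j) (normal_word d j)"
    assume "u \<in> gca_indices m d \<rightarrow>\<^sub>E UNIV \<and> gca_equiv m d p ?S"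
    then have ext: "u \<in> gca_indices m d \<rightarrow>\<^sub>E UNIV" and eq: "p - ?S \<in> gca_ideal m d"
      by (simp_all only: gca_equiv_def)
    have "u k = lin_ext (nf_coeff m (extend_zero d k)) p" if k: "k \<in> gca_indices m d" for k
    proof -
      \<comment> \<open>The functional dual to \<open>k\<close> kills the ideal, and by duality it
        reads off \<open>u k\<close> from the sum.\<close>
      have "lin_ext (nf_coeff m (extend_zero d k)) p - lin_ext (nf_coeff m (extend_zero d k)) ?S = 0"
        unfolding lin_ext_diff[symmetric] by (rule lin_ext_nf_coeff_gca_ideal[OF assms(1) eq])
      then have "lin_ext (nf_coeff m (extend_zero d k)) p = lin_ext (nf_coeff m (extend_zero d k)) ?S"
        by (rule eq_iff_diff_eq_0[THEN iffD2])
      also have "\<dots> = (\<Sum>j\<in>gca_indices m d. u j * of_bool (j = k))"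
        unfolding lin_ext_sum
        by (intro sum.cong) (simp_all only: lin_ext_single nf_coeff_normal_word[OF assms(1) _ k])
      also have "\<dots> = u k"
        using k by (simp add: finite_gca_indices)
      finally show ?thesis by simp
    qed
    then show "u = (\<lambda>j\<in>gca_indices m d. lin_ext (nf_coeff m (extend_zero d j)) p)"
      using ext by (intro extensionalityI[of _ "gca_indices m d"]) (auto simp: PiE_iff)
  qed
qed

section \<open>The grade-0 functional and the trace property\<close>

lemma grade0_class:
  assumes "m > 0" "p \<in> carrier (free_alg d)"
  shows "grade0 m d (gca_class m d p) = lin_ext (nf_coeff m (\<lambda>_. 0)) p"
proof -
  have "(\<lambda>i\<in>{1..d}. 0) \<in> gca_indices m d"
    by (auto simp: gca_indices_def)
  \<comment> \<open>The extensional zero index thus selects the functional whose prescribed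
    exponents all vanish.\<close>
  moreover have "extend_zero d (\<lambda>i\<in>{1..d}. 0) = (\<lambda>_. 0)"
    by (auto simp: extend_zero_def)
  ultimately show ?thesis
    by (simp add: grade0_def gca_coeffs_class[OF assms])
qed

theorem corollary7p2:
  fixes m d :: nat
  assumes "m \<ge> 2" and "d \<ge> 1"
  shows "\<forall>U \<in> carrier (gen_clifford m d). \<forall>V \<in> carrier (gen_clifford m d).
           grade0 m d (U \<otimes>\<^bsub>gen_clifford m d\<^esub> V) = grade0 m d (V \<otimes>\<^bsub>gen_clifford m d\<^esub> U)"
proof (intro ballI)
  fix U V assume "U \<in> carrier (gen_clifford m d)" "V \<in> carrier (gen_clifford m d)"
  then obtain p q where p: "p \<in> carrier (free_alg d)" "U = gca_class m d p"
    and q: "q \<in> carrier (free_alg d)" "V = gca_class m d q"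
    by (metis gen_clifford_carrierE)
  have m: "m > 0" using assms by simp
  \<comment> \<open>On representatives the claim is the symmetry of a single functional on the free
    algebra.\<close>
  have trace: "lin_ext (nf_coeff m (\<lambda>_. 0)) (p * q) = lin_ext (nf_coeff m (\<lambda>_. 0)) (q * p)"
    by (rule lin_ext_trace) (rule nf_coeff_zero_commute[OF m])
  have "p * q \<in> carrier (free_alg d)" "q * p \<in> carrier (free_alg d)"
    using ring.ring_simprules(5)[OF ring_free_alg, of _ d] p q by (simp_all add: free_alg_simps)
  then show "grade0 m d (U \<otimes>\<^bsub>gen_clifford m d\<^esub> V) = grade0 m d (V \<otimes>\<^bsub>gen_clifford m d\<^esub> U)"
    using p q m trace by (simp add: gca_class_mult grade0_class)
qed

end
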